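(* Let $\mathbb H$ be the upper half plane and let $\mathrm{GL}^+(2,\mathbb Q)$ be the index two subgroup of $\mathrm{GL}(2,\mathbb Q)$ consisting of the elements $M$ such that $\det M > 0$. Let $\tau\in\mathbb H$ and let $w=\varphi(z)$ be a holomorphic function defined over a neighbourhood of $\tau$. Assume that $\varphi(\tau)\in\mathbb H$. Then there exists a sequence $\{\tau_k\}_{k=0}^\infty\subset\mathbb H-\{\tau\}$ such that $\lim_{k\to\infty}\tau_k=\tau$ and such that, for each $k$, $\tau_k$ and $\varphi(\tau_k)$ are congruent with respect to the standard linear fractional action of $\mathrm{GL}^+(2,\mathbb Q)$ on $\mathbb H$.
   Context: Two points of $\mathbb H$ are congruent with respect to the group action if they lie in the same $\mathrm{GL}^+(2,\mathbb Q)$-orbit, where $\begin{pmatrix} a&b\\c&d\end{pmatrix}$ acts by $z\mapsto (az+b)/(cz+d)$. *)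

theory Defs
  imports "HOL-Analysis.Analysis"
begin

definition upper_half_plane :: "complex set" where
  "upper_half_plane = {z. Im z > 0}"

definition GL2Q_plus :: "(rat ^ 2 ^ 2) set" where
  "GL2Q_plus = {M. invertible M \<and> det M > 0}"

text \<open>
  In \<open>M $ i $ j\<close> the index \<open>i\<close> is the row and \<open>j\<close> the column.  The action is only used for
  \<open>M\<close> of positive determinant and \<open>z\<close> in the upper half plane, where the denominator is nonzero.
\<close>

definition moebius_act :: "rat ^ 2 ^ 2 \<Rightarrow> complex \<Rightarrow> complex" where
  "moebius_act M z =
     moebius (of_rat (M $ 1 $ 1)) (of_rat (M $ 1 $ 2)) (of_rat (M $ 2 $ 1)) (of_rat (M $ 2 $ 2)) z"

definition GL2Q_orbit :: "complex \<Rightarrow> complex set" where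
  "GL2Q_orbit u = (\<lambda>M. moebius_act M u) ` GL2Q_plus"

definition GL2Q_congruent :: "complex \<Rightarrow> complex \<Rightarrow> bool" where
  "GL2Q_congruent z w \<longleftrightarrow> (\<exists>u\<in>upper_half_plane. z \<in> GL2Q_orbit u \<and> w \<in> GL2Q_orbit u)"

lemma moebius_denom_nonzero:
  assumes "M \<in> GL2Q_plus" "z \<in> upper_half_plane"
  shows "of_rat (M $ 2 $ 1) * z + of_rat (M $ 2 $ 2) \<noteq> (0 :: complex)"
proof
  assume *: "of_rat (M $ 2 $ 1) * z + of_rat (M $ 2 $ 2) = (0 :: complex)"
  have r: "of_rat q = complex_of_real (of_rat q)" for q
    by (cases q) (simp add: of_rat_rat)
  have "of_rat (M $ 2 $ 1) * Im z = 0"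
    using arg_cong[OF *, of Im] by (simp add: r)
  then have c: "M $ 2 $ 1 = 0"
    using assms(2) by (simp add: upper_half_plane_def)
  with * have "M $ 2 $ 2 = 0"
    by simp
  with c assms(1) show False
    by (simp add: GL2Q_plus_def det_2)
qed

lemma moebius_act_upper_half_plane:
  assumes "M \<in> GL2Q_plus" "z \<in> upper_half_plane"
  shows "moebius_act M z \<in> upper_half_plane"
proof -
  have r: "of_rat q = complex_of_real (of_rat q)" for q
    by (cases q) (simp add: of_rat_rat)
  define a b c d :: real where
    "a = of_rat (M $ 1 $ 1)" and "b = of_rat (M $ 1 $ 2)" and
    "c = of_rat (M $ 2 $ 1)" and "d = of_rat (M $ 2 $ 2)"
  have act: "moebius_act M z = (of_real a * z + of_real b) / (of_real c * z + of_real d)"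
    unfolding moebius_act_def moebius_def a_def b_def c_def d_def by (simp only: r)
  have "of_real c * z + of_real d \<noteq> 0"
    using moebius_denom_nonzero[OF assms] unfolding c_def d_def by (simp only: r not_False_eq_True)
  then have pos: "(cmod (of_real c * z + of_real d))\<^sup>2 > 0"
    by simp
  have "det M > 0"
    using assms(1) by (simp add: GL2Q_plus_def)
  then have "real_of_rat (det M) > 0"
    by simp
  then have D: "a * d - b * c > 0"
    by (simp add: det_2 a_def b_def c_def d_def of_rat_diff of_rat_mult)
  have "Im (moebius_act M z) = (a * d - b * c) * Im z / (cmod (of_real c * z + of_real d))\<^sup>2"
    by (simp add: act Im_divide cmod_power2 algebra_simps)
  with pos D assms(2) show ?thesis
    by (simp add: upper_half_plane_def)
qed

end

theory Submission
  imports Defs "HOL-Complex_Analysis.Great_Picard"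
begin

text \<open>
  A point \<open>z\<close> in the upper half plane is carried to \<open>\<phi> z\<close> by the affine map \<open>z \<mapsto> p z + q\<close> with
  rational \<open>p > 0\<close> and \<open>q\<close> precisely when \<open>\<phi> z - (p z + q)\<close> vanishes at \<open>z\<close>.  There are unique
  real numbers \<open>a > 0\<close> and \<open>b\<close> with \<open>\<phi> \<tau> = a \<tau> + b\<close>.  If \<open>\<phi> - (a z + b)\<close> is not constant near
  \<open>\<tau>\<close>, its zero at \<open>\<tau>\<close> persists, by Hurwitz's theorem, when \<open>a\<close> and \<open>b\<close> are moved slightly to
  rational values \<open>p\<close> and \<open>q\<close>.  Taking \<open>p \<noteq> a\<close> forces the zero of the perturbed function to
  differ from \<open>\<tau>\<close>, because \<open>p \<tau> + q\<close> and \<open>a \<tau> + b\<close> then have different imaginary parts.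
  This is \<open>rational_affine_coincidence\<close>.

  The remaining problem is that \<open>\<phi>\<close> might itself be the map \<open>a z + b\<close>, which happens only if
  \<open>deriv \<phi> \<tau> = a\<close>.  In that case the same argument is applied to \<open>\<psi> = -1 / \<phi>\<close>, whose values are
  congruent to those of \<open>\<phi>\<close>: here \<open>deriv \<psi> \<tau> = a / (\<phi> \<tau>)\<^sup>2\<close>, which is not real and positive since
  \<open>\<phi> \<tau>\<close> is not real, so \<open>\<psi>\<close> cannot be a real affine map.
\<close>

lemma of_rat_eq_of_real: "of_rat q = complex_of_real (of_rat q)"
  by (cases q) (simp add: of_rat_rat)

lemma rational_sequence_from_above:
  fixes a :: real
  obtains p :: "nat \<Rightarrow> rat"
  where "\<And>n. a < of_rat (p n)" "(\<lambda>n. real_of_rat (p n)) \<longlonglongrightarrow> a"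
proof -
  have "\<exists>q::rat. a < of_rat q \<and> of_rat q < a + 1 / (Suc n)" for n
    by (rule of_rat_dense) simp
  then obtain p :: "nat \<Rightarrow> rat"
    where p: "\<And>n. a < of_rat (p n)" "\<And>n. of_rat (p n) < a + 1 / (Suc n)"
    by metis
  have "(\<lambda>n. real_of_rat (p n)) \<longlonglongrightarrow> a"
  proof (rule metric_tendsto_imp_tendsto[OF LIMSEQ_Suc[OF lim_1_over_n]])
    have "dist (real_of_rat (p n)) a \<le> dist (1 / real (Suc n)) 0" for n
      using p[of n] by (simp add: dist_real_def)
    then show "\<forall>\<^sub>F n in sequentially. dist (real_of_rat (p n)) a \<le> dist (1 / real (Suc n)) 0"
      by simp
  qed
  with p(1) that show thesis by blast
qed

lemma congruent_moebius:
  assumes "z \<in> upper_half_plane" and "a * d - b * c > 0"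
    and "w = moebius (of_rat a) (of_rat b) (of_rat c) (of_rat d) z"
  shows "GL2Q_congruent z w"
proof -
  define M :: "rat ^ 2 ^ 2" where "M = vector [vector [a, b], vector [c, d]]"
  have "M \<in> GL2Q_plus"
    using assms(2) by (simp add: M_def GL2Q_plus_def det_2 invertible_det_nz)
  moreover have "w = moebius_act M z"
    by (simp add: M_def moebius_act_def assms(3))
  moreover have "mat 1 \<in> GL2Q_plus"
    by (simp add: GL2Q_plus_def invertible_det_nz)
  moreover have "z = moebius_act (mat 1) z"
    by (simp add: moebius_act_def moebius_def mat_def)
  ultimately show ?thesis
    using assms(1) unfolding GL2Q_congruent_def GL2Q_orbit_def by blast
qed

lemma uniform_limit_minus_affine:
  fixes f :: "complex \<Rightarrow> complex" and p q :: "nat \<Rightarrow> complex"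
  assumes "bounded K" and p: "p \<longlonglongrightarrow> a" and q: "q \<longlonglongrightarrow> b"
  shows "uniform_limit K (\<lambda>n z. f z - (p n * z + q n)) (\<lambda>z. f z - (a * z + b)) sequentially"
proof (rule uniform_limitI)
  fix e :: real assume "e > 0"
  obtain B where B: "\<And>z. z \<in> K \<Longrightarrow> cmod z \<le> B"
    using assms(1) unfolding bounded_iff by blast
  have "(\<lambda>n. cmod (p n - a) * B + cmod (q n - b)) \<longlonglongrightarrow> cmod (a - a) * B + cmod (b - b)"
    by (intro tendsto_intros p q)
  then have "\<forall>\<^sub>F n in sequentially. cmod (p n - a) * B + cmod (q n - b) < e"
    using \<open>e > 0\<close> by (intro order_tendstoD(2)[where a = e]) auto
  then show "\<forall>\<^sub>F n in sequentially. \<forall>z\<in>K. dist (f z - (p n * z + q n)) (f z - (a * z + b)) < e"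
  proof eventually_elim
    case (elim n)
    show ?case
    proof
      fix z assume "z \<in> K"
      have "dist (f z - (p n * z + q n)) (f z - (a * z + b)) = cmod ((p n - a) * z + (q n - b))"
        by (simp add: dist_norm norm_minus_commute algebra_simps)
      also have "\<dots> \<le> cmod (p n - a) * cmod z + cmod (q n - b)"
        by (metis norm_triangle_ineq norm_mult)
      also have "\<dots> \<le> cmod (p n - a) * B + cmod (q n - b)"
        using B[OF \<open>z \<in> K\<close>] by (simp add: mult_left_mono)
      finally show "dist (f z - (p n * z + q n)) (f z - (a * z + b)) < e"
        using elim by linarith
    qed
  qed
qed

text \<open>
  The stability of zeros under perturbation.  The condition on the derivative is a pointwise
  criterion for \<open>f\<close> not to be the affine map \<open>a z + b\<close>, where \<open>a\<close> is the quotient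
  \<open>Im (f \<tau>) / Im \<tau>\<close>.
\<close>

lemma rational_affine_coincidence:
  fixes f :: "complex \<Rightarrow> complex"
  assumes S: "open S" "connected S" and "\<tau> \<in> S" and holf: "f holomorphic_on S"
    and "Im \<tau> > 0" and "Im (f \<tau>) > 0"
    and deriv: "deriv f \<tau> \<noteq> of_real (Im (f \<tau>) / Im \<tau>)"
  obtains z :: complex and p q :: rat
  where "z \<in> S - {\<tau>}" "p > 0" "f z = of_rat p * z + of_rat q"
proof -
  define a where "a = Im (f \<tau>) / Im \<tau>"
  define b where "b = Re (f \<tau>) - a * Re \<tau>"
  have "a > 0"
    using assms by (simp add: a_def)
  have f\<tau>: "f \<tau> = of_real a * \<tau> + of_real b"
    using \<open>Im \<tau> > 0\<close> by (simp add: complex_eq_iff a_def b_def)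
  obtain p where p: "\<And>n. a < of_rat (p n)" "(\<lambda>n. real_of_rat (p n)) \<longlonglongrightarrow> a"
    using rational_sequence_from_above by blast
  obtain q where q: "(\<lambda>n. real_of_rat (q n)) \<longlonglongrightarrow> b"
    using rational_sequence_from_above by blast
  define F where "F n z = f z - (of_rat (p n) * z + of_rat (q n))" for n z
  define g where "g z = f z - (of_real a * z + of_real b)" for z
  have lim_p: "(\<lambda>n. of_rat (p n)) \<longlonglongrightarrow> complex_of_real a"
    and lim_q: "(\<lambda>n. of_rat (q n)) \<longlonglongrightarrow> complex_of_real b"
    unfolding of_rat_eq_of_real by (intro tendsto_of_real p q)+
  have "\<exists>n. \<exists>z\<in>S. F n z = 0"
  proof (rule ccontr)
    assume no_zero: "\<not> (\<exists>n. \<exists>z\<in>S. F n z = 0)"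
    have "(f has_field_derivative deriv f \<tau>) (at \<tau>)"
      using holf S(1) \<open>\<tau> \<in> S\<close> holomorphic_derivI by blast
    then have "(g has_field_derivative deriv f \<tau> - of_real a) (at \<tau>)"
      unfolding g_def by (auto intro!: derivative_eq_intros)
    then have "deriv g \<tau> \<noteq> 0"
      using deriv by (simp add: DERIV_imp_deriv a_def)
    have "\<not> g constant_on S"
    proof
      assume "g constant_on S"
      then obtain c where c: "\<And>z. z \<in> S \<Longrightarrow> g z = c"
        unfolding constant_on_def by blast
      have "deriv g \<tau> = deriv (\<lambda>z. c) \<tau>"
        using eventually_nhds_in_open[OF S(1) \<open>\<tau> \<in> S\<close>]
        by (intro deriv_cong_ev) (auto elim!: eventually_mono simp: c)
      with \<open>deriv g \<tau> \<noteq> 0\<close> show False by simp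
    qed
    then have "g \<tau> \<noteq> 0"
    proof (rule Hurwitz_no_zeros[OF S, rotated 3])
      show "F n holomorphic_on S" for n
        unfolding F_def by (intro holomorphic_intros holf)
      show "g holomorphic_on S"
        unfolding g_def by (intro holomorphic_intros holf)
      show "uniform_limit K F g sequentially" if "compact K" for K
        unfolding F_def g_def
        by (rule uniform_limit_minus_affine[OF compact_imp_bounded[OF that] lim_p lim_q])
    qed (use no_zero \<open>\<tau> \<in> S\<close> in auto)
    then show False
      by (simp add: g_def f\<tau>)
  qed
  then obtain n z where z: "z \<in> S" "f z = of_rat (p n) * z + of_rat (q n)"
    by (auto simp: F_def)
  have "z \<noteq> \<tau>"
  proof
    assume "z = \<tau>"
    then have "of_real a * \<tau> + of_real b = of_rat (p n) * \<tau> + of_rat (q n)"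
      using z(2) f\<tau> by metis
    then have "a * Im \<tau> = of_rat (p n) * Im \<tau>"
      by (simp add: complex_eq_iff of_rat_eq_of_real)
    with p(1)[of n] \<open>Im \<tau> > 0\<close> show False by simp
  qed
  moreover have "p n > 0"
    using less_trans[OF \<open>a > 0\<close> p(1)[of n]] by (simp only: zero_less_of_rat_iff)
  ultimately show thesis
    using that z by blast
qed

text \<open>
  Passing to \<open>-1 / \<phi>\<close> when the derivative of \<open>\<phi>\<close> at \<open>\<tau>\<close> is the exceptional real number removes
  the exception.
\<close>

lemma congruent_value_in_neighbourhood:
  fixes \<phi> :: "complex \<Rightarrow> complex"
  assumes S: "open S" "connected S" and "\<tau> \<in> S" and sub: "S \<subseteq> upper_half_plane"
    and hol: "\<phi> holomorphic_on S" and nz: "\<And>z. z \<in> S \<Longrightarrow> \<phi> z \<noteq> 0"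
    and "\<phi> \<tau> \<in> upper_half_plane"
  obtains z where "z \<in> S - {\<tau>}" "GL2Q_congruent z (\<phi> z)"
proof -
  define a where "a = Im (\<phi> \<tau>) / Im \<tau>"
  have Im: "Im \<tau> > 0" "Im (\<phi> \<tau>) > 0"
    using assms by (auto simp: upper_half_plane_def)
  show thesis
  proof (cases "deriv \<phi> \<tau> = of_real a")
    case False
    obtain z p q where z: "z \<in> S - {\<tau>}" "p > 0" "\<phi> z = of_rat p * z + of_rat q"
      using rational_affine_coincidence[OF S \<open>\<tau> \<in> S\<close> hol Im] False unfolding a_def by blast
    have "GL2Q_congruent z (\<phi> z)"
      by (rule congruent_moebius[of _ p 1 q 0]) (use z sub in \<open>auto simp: moebius_def\<close>)
    with z(1) that show thesis by blast
  next
    case True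
    define \<psi> where "\<psi> z = - 1 / \<phi> z" for z
    have hol\<psi>: "\<psi> holomorphic_on S"
      unfolding \<psi>_def by (intro holomorphic_intros hol nz)
    have Im\<psi>: "Im (\<psi> \<tau>) > 0"
      using Im nz[OF \<open>\<tau> \<in> S\<close>] by (simp add: \<psi>_def Im_divide sum_power2_gt_zero_iff)
    have "(\<phi> has_field_derivative of_real a) (at \<tau>)"
      using hol S(1) \<open>\<tau> \<in> S\<close> holomorphic_derivI True by metis
    then have "(\<psi> has_field_derivative of_real a / (\<phi> \<tau>)\<^sup>2) (at \<tau>)"
      unfolding \<psi>_def using nz[OF \<open>\<tau> \<in> S\<close>]
      by (auto intro!: derivative_eq_intros simp: power2_eq_square)
    then have d\<psi>: "deriv \<psi> \<tau> = of_real a / (\<phi> \<tau>)\<^sup>2"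
      by (rule DERIV_imp_deriv)
    have "deriv \<psi> \<tau> \<noteq> of_real (Im (\<psi> \<tau>) / Im \<tau>)"
    proof
      define c where "c = Im (\<psi> \<tau>) / Im \<tau>"
      assume "deriv \<psi> \<tau> = of_real (Im (\<psi> \<tau>) / Im \<tau>)"
      then have eq: "of_real a = of_real c * (\<phi> \<tau>)\<^sup>2"
        using d\<psi> nz[OF \<open>\<tau> \<in> S\<close>] by (simp add: c_def field_simps)
      have "a > 0" "c > 0"
        using Im Im\<psi> by (simp_all add: a_def c_def)
      \<comment> \<open>The square of \<open>\<phi> \<tau>\<close> would be the positive real \<open>a / c\<close>. Its imaginary part shows that
        \<open>\<phi> \<tau>\<close> is then purely imaginary, which makes the square negative.\<close>
      have "Re (\<phi> \<tau>) = 0"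
        using arg_cong[OF eq, of Im] \<open>c > 0\<close> Im by (simp add: power2_eq_square)
      then have "a = - (c * (Im (\<phi> \<tau>))\<^sup>2)"
        using arg_cong[OF eq, of Re] by (simp add: power2_eq_square)
      moreover have "c * (Im (\<phi> \<tau>))\<^sup>2 \<ge> 0"
        using \<open>c > 0\<close> by simp
      ultimately show False
        using \<open>a > 0\<close> by linarith
    qed
    then obtain z p q where z: "z \<in> S - {\<tau>}" "p > 0" "\<psi> z = of_rat p * z + of_rat q"
      using rational_affine_coincidence[OF S \<open>\<tau> \<in> S\<close> hol\<psi> Im(1) Im\<psi>] by blast
    have "\<phi> z = - 1 / \<psi> z"
      by (simp add: \<psi>_def)
    then have "GL2Q_congruent z (\<phi> z)"
      by (intro congruent_moebius[of _ 0 q "-1" p]) (use z sub in \<open>auto simp: moebius_def\<close>)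
    with z(1) that show thesis by blast
  qed
qed

theorem corollary3:
  fixes \<tau> :: complex and \<phi> :: "complex \<Rightarrow> complex" and U :: "complex set"
  assumes "\<tau> \<in> upper_half_plane"
    and "open U" and "\<tau> \<in> U"
    and "\<phi> holomorphic_on U"
    and "\<phi> \<tau> \<in> upper_half_plane"
  shows "\<exists>t :: nat \<Rightarrow> complex.
           (\<forall>k. t k \<in> upper_half_plane - {\<tau>}) \<and>
           t \<longlonglongrightarrow> \<tau> \<and>
           (\<forall>k. t k \<in> U \<and> GL2Q_congruent (t k) (\<phi> (t k)))"
proof -
  have openH: "open upper_half_plane"
    unfolding upper_half_plane_def by (rule open_halfspace_Im_gt)
  define V where "V = (U \<inter> \<phi> -` upper_half_plane) \<inter> upper_half_plane"
  have "open V"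
    unfolding V_def
    by (intro open_Int continuous_open_preimage holomorphic_on_imp_continuous_on assms openH)
  moreover have "\<tau> \<in> V"
    using assms by (simp add: V_def)
  ultimately obtain R where R: "R > 0" "ball \<tau> R \<subseteq> V"
    using open_contains_ball by blast
  have "\<exists>z. z \<in> ball \<tau> (min R (1 / Suc k)) - {\<tau>} \<and> GL2Q_congruent z (\<phi> z)" for k
  proof -
    let ?S = "ball \<tau> (min R (1 / Suc k))"
    have "?S \<subseteq> V"
      using R(2) by auto
    then have S: "\<phi> holomorphic_on ?S" "?S \<subseteq> upper_half_plane" "\<And>z. z \<in> ?S \<Longrightarrow> \<phi> z \<noteq> 0"
      using holomorphic_on_subset[OF assms(4)] by (auto simp: V_def upper_half_plane_def)
    have "\<tau> \<in> ?S"
      using R(1) by simp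
    then obtain z where "z \<in> ?S - {\<tau>}" "GL2Q_congruent z (\<phi> z)"
      using congruent_value_in_neighbourhood[of ?S \<tau> \<phi>, OF open_ball connected_ball _ S(2,1,3) assms(5)]
      by blast
    then show ?thesis by blast
  qed
  then obtain t where t: "\<And>k. t k \<in> ball \<tau> (min R (1 / Suc k)) - {\<tau>}"
      "\<And>k. GL2Q_congruent (t k) (\<phi> (t k))"
    by metis
  have "t \<longlonglongrightarrow> \<tau>"
  proof (rule metric_tendsto_imp_tendsto[OF LIMSEQ_Suc[OF lim_1_over_n]])
    have "dist (t k) \<tau> \<le> dist (1 / real (Suc k)) 0" for k
      using t(1)[of k] by (simp add: dist_commute dist_real_def)
    then show "\<forall>\<^sub>F k in sequentially. dist (t k) \<tau> \<le> dist (1 / real (Suc k)) 0"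
      by simp
  qed
  moreover have "t k \<in> V - {\<tau>}" for k
    using t(1)[of k] R(2) by auto
  ultimately show ?thesis
    using t(2) unfolding V_def by blast
qed

end
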